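(* Let $\mathbb{k}$ be an algebraically closed field of characteristic $0$ and let $d\ge 6$ be an integer. Let $\mathcal{X}_d\subseteq\mathbb{P}^d$ be the moment variety of first order local mixtures of Dirac measures, and let $I_d\subseteq \mathbb{k}[M_0,M_1,\dots,M_d]$ be its homogeneous vanishing ideal. Let $J_d\subseteq \mathbb{k}[M_0,M_1,\dots,M_d]$ be the ideal generated by the $\binom{d-2}{2}$ polynomials $$f_{i,j} = (j-i+3)\,M_iM_{j}-2(j-i+2)\,M_{i-1}M_{j+1}+(j-i+1)\,M_{i-2}M_{j+2},\qquad 2\le i\le j\le d-2.$$ Then $J_d=I_d$.
   Context: The moments of the first order local mixture of a univariate Dirac measure with parameters $\xi,\alpha\in\mathbb{k}$ are $m_0=1$ and $m_i=\xi^i+i\alpha\xi^{i-1}$ for $i\ge 1$. The moment variety $\mathcal{X}_d\subseteq\mathbb{P}^d$ (projective space over $\mathbb{k}$ with homogeneous coordinates $M_0,\dots,M_d$) is the Zariski closure of the set of points $[m_0:m_1:\cdots:m_d]$ obtained for all $(\xi,\alpha)\in\mathbb{k}^2$. *)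

theory Defs
  imports
    "HOL-Library.Poly_Mapping"
    "HOL-Algebra.Algebraic_Closure_Type"
begin

text \<open>
  Monomials are finitely supported exponent maps on \<open>nat\<close>, and polynomials are finitely
  supported coefficient maps on monomials; multiplication of \<open>\<Rightarrow>\<^sub>0\<close> is convolution, so the type
  below is the polynomial ring in the variables \<open>M\<^sub>0, M\<^sub>1, \<dots>\<close>.
\<close>

type_synonym 'k mvpoly = "(nat \<Rightarrow>\<^sub>0 nat) \<Rightarrow>\<^sub>0 'k"

definition mvar :: "nat \<Rightarrow> 'k::comm_ring_1 mvpoly" where
  "mvar i = Poly_Mapping.single (Poly_Mapping.single i 1) 1"

definition mvars :: "'k::comm_ring_1 mvpoly \<Rightarrow> nat set" where
  "mvars p = (\<Union>m\<in>Poly_Mapping.keys p. Poly_Mapping.keys m)"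

definition monom_degree :: "(nat \<Rightarrow>\<^sub>0 nat) \<Rightarrow> nat" where
  "monom_degree m = (\<Sum>i\<in>Poly_Mapping.keys m. Poly_Mapping.lookup m i)"

definition mvpoly_eval :: "(nat \<Rightarrow> 'k) \<Rightarrow> 'k::comm_ring_1 mvpoly \<Rightarrow> 'k" where
  "mvpoly_eval v p = (\<Sum>m\<in>Poly_Mapping.keys p.
     Poly_Mapping.lookup p m * (\<Prod>i\<in>Poly_Mapping.keys m. v i ^ Poly_Mapping.lookup m i))"

text \<open>As usual, the zero polynomial counts as homogeneous (of every degree).\<close>

definition homogeneous :: "'k::comm_ring_1 mvpoly \<Rightarrow> bool" where
  "homogeneous p \<longleftrightarrow> (\<exists>n. \<forall>m\<in>Poly_Mapping.keys p. monom_degree m = n)"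

text \<open>
  Ideals have to be taken in \<open>k[M\<^sub>0, \<dots>, M\<^sub>d]\<close> rather than in the whole type, hence the ring
  with restricted carrier.
\<close>

definition mvpoly_ring :: "nat \<Rightarrow> 'k::comm_ring_1 mvpoly ring" where
  "mvpoly_ring d = ring_of_type_algebra \<lparr>carrier := {p. mvars p \<subseteq> {..d}}\<rparr>"

lemma mvars_add: "mvars (p + q) \<subseteq> mvars p \<union> mvars q"
  using Poly_Mapping.keys_add[of p q] by (auto simp: mvars_def)

lemma mvars_uminus [simp]: "mvars (- p) = mvars p"
  by (simp add: mvars_def Poly_Mapping.keys_def)

lemma mvars_minus: "mvars (p - q) \<subseteq> mvars p \<union> mvars q"
  using mvars_add[of p "- q"] by simp

lemma mvars_mult: "mvars (p * q) \<subseteq> mvars p \<union> mvars q"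
proof
  fix i assume "i \<in> mvars (p * q)"
  then obtain m where m: "m \<in> Poly_Mapping.keys (p * q)" "i \<in> Poly_Mapping.keys m"
    by (auto simp: mvars_def)
  then obtain a b where "m = a + b" "a \<in> Poly_Mapping.keys p" "b \<in> Poly_Mapping.keys q"
    using Poly_Mapping.keys_mult[of p q] by blast
  with m Poly_Mapping.keys_add[of a b] show "i \<in> mvars p \<union> mvars q"
    by (auto simp: mvars_def)
qed

lemma mvars_one [simp]: "mvars 1 = {}"
  by (auto simp: mvars_def)

lemma mvars_zero [simp]: "mvars 0 = {}"
  by (auto simp: mvars_def)

lemma mvars_of_nat [simp]: "mvars (of_nat n) = {}"
proof (induction n)
  case (Suc n)
  then show ?case using mvars_add[of 1 "of_nat n :: 'a mvpoly"] by auto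
qed simp

lemma mvars_mvar: "mvars (mvar i) \<subseteq> {i}"
  by (auto simp: mvars_def mvar_def split: if_splits)

lemma mvpoly_ring_simps [simp]:
  "carrier (mvpoly_ring d) = {p. mvars p \<subseteq> {..d}}"
  "x \<otimes>\<^bsub>mvpoly_ring d\<^esub> y = x * y"
  "x \<oplus>\<^bsub>mvpoly_ring d\<^esub> y = x + y"
  "\<one>\<^bsub>mvpoly_ring d\<^esub> = 1"
  "\<zero>\<^bsub>mvpoly_ring d\<^esub> = 0"
  by (simp_all add: mvpoly_ring_def ring_of_type_algebra_def)

lemma cring_mvpoly_ring: "cring (mvpoly_ring d :: 'k::comm_ring_1 mvpoly ring)"
proof (rule cringI)
  have neg: "\<exists>q. mvars q \<subseteq> {..d} \<and> p + q = 0" if "mvars p \<subseteq> {..d}" for p :: "'k mvpoly"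
    by (rule exI[of _ "- p"]) (use that in simp)
  have add: "mvars (p + q) \<subseteq> {..d}" and mult: "mvars (p * q) \<subseteq> {..d}"
    if "mvars p \<subseteq> {..d}" "mvars q \<subseteq> {..d}" for p q :: "'k mvpoly"
    using that mvars_add[of p q] mvars_mult[of p q] by blast+
  show "abelian_group (mvpoly_ring d :: 'k mvpoly ring)"
    by (rule abelian_groupI) (simp_all add: neg add add_ac)
  show "Group.comm_monoid (mvpoly_ring d :: 'k mvpoly ring)"
    by (rule comm_monoidI) (simp_all add: mult mult_ac)
qed (simp add: ring_distribs)

text \<open>
  A vector of \<open>k\<^sup>d\<^sup>+\<^sup>1\<close> is a function on \<open>nat\<close> vanishing beyond \<open>d\<close>. Points of \<open>P\<^sup>d\<close> are the
  classes of nonzero vectors modulo scaling by nonzero constants.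
\<close>

definition homog_coords :: "nat \<Rightarrow> (nat \<Rightarrow> 'k::field) set" where
  "homog_coords d = {v. (\<forall>i>d. v i = 0) \<and> (\<exists>i. v i \<noteq> 0)}"

definition proj_rel :: "nat \<Rightarrow> ((nat \<Rightarrow> 'k::field) \<times> (nat \<Rightarrow> 'k)) set" where
  "proj_rel d = {(v, w). v \<in> homog_coords d \<and> w \<in> homog_coords d \<and>
     (\<exists>c. c \<noteq> 0 \<and> w = (\<lambda>i. c * v i))}"

definition proj_space :: "nat \<Rightarrow> (nat \<Rightarrow> 'k::field) set set" where
  "proj_space d = homog_coords d // proj_rel d"

text \<open>The point \<open>[v\<^sub>0 : \<dots> : v\<^sub>d]\<close>; entries of \<open>v\<close> beyond \<open>d\<close> are discarded.\<close>

definition proj_point :: "nat \<Rightarrow> (nat \<Rightarrow> 'k::field) \<Rightarrow> (nat \<Rightarrow> 'k) set" where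
  "proj_point d v = proj_rel d `` {\<lambda>i. if i \<le> d then v i else 0}"

definition vanishes_at :: "'k::field mvpoly \<Rightarrow> (nat \<Rightarrow> 'k) set \<Rightarrow> bool" where
  "vanishes_at p P \<longleftrightarrow> (\<forall>v\<in>P. mvpoly_eval v p = 0)"

definition zariski_closed :: "nat \<Rightarrow> (nat \<Rightarrow> 'k::field) set set \<Rightarrow> bool" where
  "zariski_closed d Z \<longleftrightarrow>
     (\<exists>S. S \<subseteq> {p \<in> carrier (mvpoly_ring d). homogeneous p} \<and>
          Z = {P \<in> proj_space d. \<forall>p\<in>S. vanishes_at p P})"

definition zariski_closure ::
  "nat \<Rightarrow> (nat \<Rightarrow> 'k::field) set set \<Rightarrow> (nat \<Rightarrow> 'k) set set" where
  "zariski_closure d A = zariski_closed d hull A"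

definition vanishing_ideal :: "nat \<Rightarrow> (nat \<Rightarrow> 'k::field) set set \<Rightarrow> 'k mvpoly set" where
  "vanishing_ideal d A = Idl\<^bsub>mvpoly_ring d\<^esub>
     {p \<in> carrier (mvpoly_ring d). homogeneous p \<and> (\<forall>P\<in>A. vanishes_at p P)}"

lemma equiv_proj_rel: "equiv (homog_coords d :: (nat \<Rightarrow> 'k::field) set) (proj_rel d)"
proof (rule equivI)
  show "proj_rel d \<subseteq> homog_coords d \<times> homog_coords d"
    by (auto simp: proj_rel_def)
  show "refl_on (homog_coords d) (proj_rel d)"
    by (auto simp: refl_on_def proj_rel_def intro: exI[of _ 1])
  show "sym (proj_rel d :: ((nat \<Rightarrow> 'k) \<times> _) set)"
  proof (rule symI)
    fix v w :: "nat \<Rightarrow> 'k" assume "(v, w) \<in> proj_rel d"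
    then obtain c where c: "v \<in> homog_coords d" "w \<in> homog_coords d" "c \<noteq> 0"
      "w = (\<lambda>i. c * v i)"
      by (auto simp: proj_rel_def)
    then have "inverse c \<noteq> 0 \<and> v = (\<lambda>i. inverse c * w i)"
      by (auto simp: fun_eq_iff)
    with c show "(w, v) \<in> proj_rel d"
      unfolding proj_rel_def by blast
  qed
  show "trans (proj_rel d :: ((nat \<Rightarrow> 'k) \<times> _) set)"
  proof (rule transI)
    fix u v w :: "nat \<Rightarrow> 'k" assume "(u, v) \<in> proj_rel d" "(v, w) \<in> proj_rel d"
    then obtain a b where ab: "u \<in> homog_coords d" "w \<in> homog_coords d" "a \<noteq> 0" "b \<noteq> 0"
      "v = (\<lambda>i. a * u i)" "w = (\<lambda>i. b * v i)"
      by (auto simp: proj_rel_def)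
    then have "b * a \<noteq> 0 \<and> w = (\<lambda>i. (b * a) * u i)"
      by (auto simp: fun_eq_iff mult_ac)
    with ab show "(u, w) \<in> proj_rel d"
      unfolding proj_rel_def by blast
  qed
qed

lemma zariski_closed_closure:
  fixes A :: "(nat \<Rightarrow> 'k::field) set set"
  assumes "A \<subseteq> proj_space d"
  shows "zariski_closed d (zariski_closure d A)"
proof -
  let ?S = "{p \<in> carrier (mvpoly_ring d :: 'k mvpoly ring).
               homogeneous p \<and> (\<forall>P\<in>A. vanishes_at p P)}"
  let ?Z = "{P \<in> proj_space d. \<forall>p\<in>?S. vanishes_at p P}"
  have closed: "zariski_closed d ?Z"
    unfolding zariski_closed_def by (rule exI[of _ ?S]) auto
  have "zariski_closed d hull A = ?Z"
  proof (rule hull_unique)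
    show "A \<subseteq> ?Z" using assms by auto
    show "zariski_closed d ?Z" by (rule closed)
    show "?Z \<subseteq> Z" if "A \<subseteq> Z" "zariski_closed d Z" for Z
    proof -
      from that(2) obtain T where
        T: "T \<subseteq> {p \<in> carrier (mvpoly_ring d). homogeneous p}"
           "Z = {P \<in> proj_space d. \<forall>p\<in>T. vanishes_at p P}"
        unfolding zariski_closed_def by blast
      then have "T \<subseteq> ?S" using that(1) by blast
      then show ?thesis unfolding T(2) by blast
    qed
  qed
  with closed show ?thesis by (simp add: zariski_closure_def)
qed

definition local_mixture_moment :: "'k::field \<Rightarrow> 'k \<Rightarrow> nat \<Rightarrow> 'k" where
  "local_mixture_moment \<xi> \<alpha> i =
     (if i = 0 then 1 else \<xi> ^ i + of_nat i * \<alpha> * \<xi> ^ (i - 1))"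

definition moment_variety :: "nat \<Rightarrow> (nat \<Rightarrow> 'k::field) set set" where
  "moment_variety d =
     zariski_closure d {proj_point d (local_mixture_moment \<xi> \<alpha>) | \<xi> \<alpha>. True}"

lemma proj_point_moment_in_proj_space:
  "proj_point d (local_mixture_moment \<xi> \<alpha>) \<in> proj_space d"
  unfolding proj_point_def proj_space_def
  by (rule quotientI) (auto simp: homog_coords_def local_mixture_moment_def intro!: exI[of _ 0])

definition moment_poly :: "nat \<Rightarrow> nat \<Rightarrow> 'k::field mvpoly" where
  "moment_poly i j =
     of_nat (j - i + 3) * mvar i * mvar j
     - 2 * of_nat (j - i + 2) * mvar (i - 1) * mvar (j + 1)
     + of_nat (j - i + 1) * mvar (i - 2) * mvar (j + 2)"

text \<open>
  The index set has \<open>(d - 2) choose 2\<close> elements. On it the natural-number subtractions \<open>j - i\<close>,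
  \<open>i - 1\<close> and \<open>i - 2\<close> do not truncate, and neither does \<open>d - 2\<close> when \<open>d \<ge> 2\<close>.
\<close>

definition moment_poly_ideal :: "nat \<Rightarrow> 'k::field mvpoly set" where
  "moment_poly_ideal d = Idl\<^bsub>mvpoly_ring d\<^esub>
     {moment_poly i j | i j. 2 \<le> i \<and> i \<le> j \<and> j \<le> d - 2}"

lemma moment_poly_in_carrier:
  assumes "2 \<le> i" "i \<le> j" "j \<le> d - 2"
  shows "(moment_poly i j :: 'k::field mvpoly) \<in> carrier (mvpoly_ring d)"
proof -
  have v: "mvars (of_nat n * mvar a * mvar b :: 'k mvpoly) \<subseteq> {..d}"
    if "a \<le> d" "b \<le> d" for n a b
    using that mvars_mult[of "of_nat n * mvar a" "mvar b :: 'k mvpoly"]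
      mvars_mult[of "of_nat n" "mvar a :: 'k mvpoly"]
      mvars_mvar[of a, where 'a = 'k] mvars_mvar[of b, where 'a = 'k]
    by fastforce
  let ?a = "of_nat (j - i + 3) * mvar i * mvar j :: 'k mvpoly"
  let ?b = "of_nat (2 * (j - i + 2)) * mvar (i - 1) * mvar (j + 1) :: 'k mvpoly"
  let ?c = "of_nat (j - i + 1) * mvar (i - 2) * mvar (j + 2) :: 'k mvpoly"
  have eq: "moment_poly i j = ?a - ?b + ?c"
    unfolding moment_poly_def of_nat_mult of_nat_numeral ..
  have "mvars ?a \<subseteq> {..d}" "mvars ?b \<subseteq> {..d}" "mvars ?c \<subseteq> {..d}"
    by (rule v; use assms in linarith)+
  then have "mvars (moment_poly i j :: 'k mvpoly) \<subseteq> {..d}"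
    unfolding eq using mvars_add[of "?a - ?b" ?c] mvars_minus[of ?a ?b] by blast
  then show ?thesis
    by simp
qed

end

theory Submission
  imports Defs
begin

text \<open>
  On the part of the variety with \<open>\<xi> \<noteq> 0\<close> and \<open>\<alpha> = \<xi> / x\<close>, the \<open>i\<close>-th moment is
  \<open>\<xi>\<^sup>i (x + i) / x\<close>. Split a homogeneous form of degree \<open>n\<close> into parts \<open>p\<close> by weight, where
  \<open>M\<^sub>i\<close> has weight \<open>i\<close>. The powers of \<open>\<xi>\<close> separate these parts, so the form vanishes on the
  variety iff every part vanishes under all substitutions \<open>M\<^sub>i \<mapsto> x + i\<close>. It remains to show
  that such a bihomogeneous \<open>p\<close>, of degree \<open>n\<close> and weight \<open>w\<close>, lies in the ideal \<open>J\<close> of the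
  quadrics.

  This is an induction on \<open>n\<close> which splits off one factor \<open>M\<^sub>0\<close> at a time. The reflection
  \<open>M\<^sub>i \<mapsto> - M\<^bsub>d-i\<^esub>\<close>, \<open>x \<mapsto> - x - d\<close> preserves all the data and replaces \<open>w\<close> by \<open>n d - w\<close>, so
  one may assume \<open>2 w \<le> n d\<close>. Put \<open>z\<^sub>i = M\<^sub>i / i\<close> for \<open>i > 0\<close>. Modulo \<open>J\<close> and \<open>M\<^sub>0\<close>, the quadrics say
  that \<open>z\<^sub>i z\<^sub>j\<close> with \<open>i, j > 0\<close> depends only on \<open>i + j\<close>, as long as \<open>i + j \<le> d\<close>. The key step
  (\<open>N_balanced\<close>) is that then all monomials in the \<open>z\<^sub>i\<close> with \<open>i > 0\<close> of the given
  degree and weight are congruent: each one can be moved, by exchanges of two or three indices,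
  to the one whose indices are as equal as possible. Hence \<open>p\<close> is congruent to a multiple of a
  single monomial, the factor being the value of \<open>p\<close> at \<open>x = 0\<close>, which is zero. So
  \<open>p \<equiv> M\<^sub>0 q\<close> modulo \<open>J\<close> with \<open>q\<close> bihomogeneous of degree \<open>n - 1\<close>; since
  \<open>x q(x) = 0\<close>, the form \<open>q\<close> again vanishes under all substitutions, and the induction
  hypothesis applies (\<open>bihom_kernel_subset\<close>).

  The converse inclusion is a direct computation with the moments.
\<close>

section \<open>Bihomogeneous elements\<close>

text \<open>
  The span of the monomials of degree \<open>n\<close> and weight \<open>w\<close> in \<open>y 0, \<dots>, y d\<close>. The sequence \<open>y\<close>
  is a parameter because the reflected sequence \<open>- y (d - i)\<close> is needed as well.
\<close>

inductive_set bihom :: "nat \<Rightarrow> ('k \<Rightarrow> 'a::comm_ring_1) \<Rightarrow> (nat \<Rightarrow> 'a) \<Rightarrow> nat \<Rightarrow> nat \<Rightarrow> 'a set"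
  for d :: nat and const :: "'k \<Rightarrow> 'a" and y :: "nat \<Rightarrow> 'a" and n w :: nat where
  zero: "0 \<in> bihom d const y n w"
| add_term: "\<lbrakk>set_mset M \<subseteq> {..d}; size M = n; sum_mset M = w; p \<in> bihom d const y n w\<rbrakk>
    \<Longrightarrow> const c * (\<Prod>i\<in>#M. y i) + p \<in> bihom d const y n w"

lemma bihom_term:
  "\<lbrakk>set_mset M \<subseteq> {..d}; size M = n; sum_mset M = w\<rbrakk>
    \<Longrightarrow> const c * (\<Prod>i\<in>#M. y i) \<in> bihom d const y n w"
  using bihom.add_term[OF _ _ _ bihom.zero, of M d n w const c y] by simp

lemma bihom_add:
  "\<lbrakk>p \<in> bihom d const y n w; q \<in> bihom d const y n w\<rbrakk> \<Longrightarrow> p + q \<in> bihom d const y n w"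
  by (induction rule: bihom.induct) (auto simp: add.assoc intro: bihom.intros)

lemma bihom_sum:
  "(\<And>x. x \<in> A \<Longrightarrow> f x \<in> bihom d const y n w) \<Longrightarrow> sum f A \<in> bihom d const y n w"
  by (induction A rule: infinite_finite_induct) (auto intro: bihom.zero bihom_add)

lemma bihom_mult_var:
  assumes "p \<in> bihom d const y n w" "i \<le> d"
  shows "y i * p \<in> bihom d const y (Suc n) (i + w)"
  using assms(1)
proof (induction rule: bihom.induct)
  case (add_term M p c)
  have "const c * (\<Prod>j\<in>#add_mset i M. y j) + y i * p \<in> bihom d const y (Suc n) (i + w)"
    using add_term assms(2) by (intro bihom.add_term) auto
  then show ?case by (simp add: algebra_simps)
qed (simp add: bihom.zero)

section \<open>Balanced multisets\<close>

lemma sum_mset_ge_size_mult: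
  "(\<And>x. x \<in># M \<Longrightarrow> e \<le> x) \<Longrightarrow> size M * e \<le> sum_mset (M :: nat multiset)"
  by (induction M) (auto intro: add_mono)

text \<open>
  The multiset of \<open>n\<close> numbers with sum \<open>w\<close> in which any two entries differ by at most one.
\<close>

definition balanced_mset :: "nat \<Rightarrow> nat \<Rightarrow> nat multiset" where
  "balanced_mset n w = replicate_mset (n - w mod n) (w div n) + replicate_mset (w mod n) (Suc (w div n))"

lemma eq_balanced_mset:
  fixes M :: "nat multiset"
  assumes e: "e \<in># M" and M: "\<And>x. x \<in># M \<Longrightarrow> x = e \<or> x = Suc e"
  shows "M = balanced_mset (size M) (sum_mset M)"
proof -
  have "M = {#x \<in># M. x = e#} + {#x \<in># M. \<not> x = e#}"
    by (rule multiset_partition)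
  also have "{#x \<in># M. \<not> x = e#} = {#x \<in># M. x = Suc e#}"
    using M by (intro filter_mset_cong) auto
  finally have split: "M = replicate_mset (count M e) e + replicate_mset (count M (Suc e)) (Suc e)"
    by (simp add: filter_eq_replicate_mset)
  define a b where "a = count M e" and "b = count M (Suc e)"
  have a: "a > 0" using e by (simp add: a_def)
  have eq: "M = replicate_mset a e + replicate_mset b (Suc e)"
    using split by (simp add: a_def b_def)
  have size: "size M = a + b" and "sum_mset M = a * e + b * Suc e"
    by (simp_all add: eq)
  then have sum: "sum_mset M = b + (a + b) * e" by (simp add: algebra_simps)
  have "sum_mset M div size M = e" "sum_mset M mod size M = b"
    using a by (simp_all add: size sum)
  then show ?thesis
    using eq by (simp add: balanced_mset_def size)
qed

section \<open>Polynomials vanishing off zero\<close>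

lemma poly_eq_0_if_zero_off_0:
  fixes E :: "'k::field_char_0 poly"
  assumes "\<And>x. x \<noteq> 0 \<Longrightarrow> poly E x = 0"
  shows "E = 0"
proof (rule ccontr)
  assume "E \<noteq> 0"
  then have "finite (insert 0 {x. poly E x = 0})" by (simp add: poly_roots_finite)
  moreover have "insert 0 {x. poly E x = 0} = UNIV" using assms by auto
  ultimately show False using infinite_UNIV_char_0 by metis
qed

section \<open>Sequences that satisfy the quadrics modulo an ideal\<close>

text \<open>
  This collects what the induction uses of \<open>y i = M\<^sub>i\<close> and of the ideal \<open>J\<close> of the quadrics,
  in a form that is stable under the reflection \<open>i \<mapsto> d - i\<close>. The map \<open>ev x\<close> is the
  substitution \<open>M\<^sub>i \<mapsto> x + i\<close>. In \<open>quadric\<close> the indices \<open>i\<close> and \<open>j\<close> of \<open>f\<^bsub>i,j\<^esub>\<close> are \<open>a + 2\<close>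
  and \<open>a + D + 2\<close>.
\<close>

locale quadric_sequence =
  fixes d :: nat
    and const :: "'k::field_char_0 \<Rightarrow> 'a::comm_ring_1"
    and J :: "'a set"
    and y :: "nat \<Rightarrow> 'a"
    and ev :: "'k \<Rightarrow> 'a \<Rightarrow> 'k"
  assumes d_ge: "6 \<le> d"
    and const_add: "const (r + s) = const r + const s"
    and const_mult: "const (r * s) = const r * const s"
    and const_1: "const 1 = 1"
    and J_0: "0 \<in> J"
    and J_add: "p \<in> J \<Longrightarrow> q \<in> J \<Longrightarrow> p + q \<in> J"
    and J_const: "p \<in> J \<Longrightarrow> const c * p \<in> J"
    and J_var: "i \<le> d \<Longrightarrow> p \<in> J \<Longrightarrow> y i * p \<in> J"
    and quadric: "a + D + 4 \<le> d \<Longrightarrow>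
       of_nat (D + 3) * y (a + 2) * y (a + D + 2) - 2 * of_nat (D + 2) * y (a + 1) * y (a + D + 3)
       + of_nat (D + 1) * y a * y (a + D + 4) \<in> J"
    and ev_add: "ev x (p + q) = ev x p + ev x q"
    and ev_mult: "ev x (p * q) = ev x p * ev x q"
    and ev_const: "ev x (const c) = c"
    and ev_var: "i \<le> d \<Longrightarrow> ev x (y i) = x + of_nat i"
    and ev_J: "p \<in> J \<Longrightarrow> ev x p = 0"
begin

lemma const_0: "const 0 = 0"
  using const_add[of 0 0] by simp

lemma const_of_nat: "const (of_nat n) = of_nat n"
  by (induction n) (simp_all add: const_0 const_add const_1)

lemma const_neg_1: "const (- 1) = - 1"
  using const_add[of 1 "- 1"] by (simp add: const_0 const_1 eq_neg_iff_add_eq_0 add.commute)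

lemma const_uminus: "const (- c) = - const c"
  using const_mult[of "- 1" c] by (simp add: const_neg_1)

lemma ev_0: "ev x 0 = 0"
  using ev_add[of x 0 0] by simp

lemma ev_monom: "set_mset M \<subseteq> {..d} \<Longrightarrow> ev x (\<Prod>i\<in>#M. y i) = (\<Prod>i\<in>#M. x + of_nat i)"
  by (induction M) (use ev_const[of x 1] in \<open>simp_all add: const_1 ev_mult ev_var\<close>)

lemma bihom_const: "p \<in> bihom d const y n w \<Longrightarrow> const c * p \<in> bihom d const y n w"
  by (induction rule: bihom.induct)
     (auto simp: distrib_left mult.assoc[symmetric] const_mult[symmetric] intro: bihom.intros)

text \<open>
  This takes the place of the ideal generated by \<open>J\<close> and \<open>y 0\<close>, in degree \<open>n + 1\<close> and weight \<open>w\<close>.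
  Keeping the cofactor of \<open>y 0\<close> bihomogeneous is what lets the induction continue with it.
\<close>

definition K :: "nat \<Rightarrow> nat \<Rightarrow> 'a set" where
  "K n w = {j + y 0 * q | j q. j \<in> J \<and> q \<in> bihom d const y n w}"

lemma K_I: "j \<in> J \<Longrightarrow> q \<in> bihom d const y n w \<Longrightarrow> j + y 0 * q \<in> K n w"
  unfolding K_def by blast

lemma J_in_K: "j \<in> J \<Longrightarrow> j \<in> K n w"
  using K_I[OF _ bihom.zero, of j] by simp

lemma K_add: "p \<in> K n w \<Longrightarrow> q \<in> K n w \<Longrightarrow> p + q \<in> K n w"
proof -
  assume "p \<in> K n w" "q \<in> K n w"
  then obtain j1 q1 j2 q2 where "j1 \<in> J" "q1 \<in> bihom d const y n w" "p = j1 + y 0 * q1"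
    "j2 \<in> J" "q2 \<in> bihom d const y n w" "q = j2 + y 0 * q2"
    unfolding K_def by blast
  with K_I[OF J_add[of j1 j2] bihom_add[of q1 d const y n w q2]] show ?thesis
    by (simp add: algebra_simps)
qed

lemma K_const: "p \<in> K n w \<Longrightarrow> const c * p \<in> K n w"
proof -
  assume "p \<in> K n w"
  then obtain j q where "j \<in> J" "q \<in> bihom d const y n w" "p = j + y 0 * q"
    unfolding K_def by blast
  with K_I[OF J_const[of j c] bihom_const[of q n w c]] show ?thesis
    by (simp add: algebra_simps)
qed

lemma K_of_nat: "p \<in> K n w \<Longrightarrow> of_nat k * p \<in> K n w"
  using K_const[of p n w "of_nat k"] by (simp add: const_of_nat)

lemma K_diff: "p \<in> K n w \<Longrightarrow> q \<in> K n w \<Longrightarrow> p - q \<in> K n w"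
  using K_add[of p n w "const (- 1) * q"] K_const[of q n w "- 1"] by (simp add: const_neg_1)

lemma K_cancel: "of_nat k * p \<in> K n w \<Longrightarrow> k > 0 \<Longrightarrow> p \<in> K n w"
  using K_const[of "of_nat k * p" n w "1 / of_nat k"]
  by (simp add: const_of_nat[symmetric] mult.assoc[symmetric] const_mult[symmetric] const_1)

lemma K_var: "p \<in> K n w \<Longrightarrow> i \<le> d \<Longrightarrow> y i * p \<in> K (Suc n) (i + w)"
proof -
  assume i: "i \<le> d" and "p \<in> K n w"
  then obtain j q where "j \<in> J" "q \<in> bihom d const y n w" "p = j + y 0 * q"
    unfolding K_def by blast
  with i K_I[OF J_var[of i j] bihom_mult_var[of q d const y n w i]] show ?thesis
    by (simp add: algebra_simps)
qed

text \<open>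
  Under \<open>ev 0\<close> every \<open>z i\<close> with \<open>0 < i\<close> becomes \<open>1\<close>, so this is the scaling in which congruence
  of monomials modulo \<open>y 0\<close> has no coefficients.
\<close>

definition z :: "nat \<Rightarrow> 'a" where
  "z i = const (1 / of_nat i) * y i"

abbreviation N :: "nat multiset \<Rightarrow> 'a" where
  "N M \<equiv> (\<Prod>i\<in>#M. z i)"

lemma y_eq: "i > 0 \<Longrightarrow> y i = of_nat i * z i"
  unfolding z_def
  by (simp add: const_of_nat[symmetric] mult.assoc[symmetric] const_mult[symmetric] const_1)

lemma monom_eq_N:
  "0 \<notin># M \<Longrightarrow> (\<Prod>i\<in>#M. y i) = of_nat (prod_mset M) * N M"
  by (induction M) (simp_all add: y_eq)

lemma K_N:
  assumes "p \<in> K n w" "set_mset R \<subseteq> {1..d}"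
  shows "N R * p \<in> K (n + size R) (w + sum_mset R)"
  using assms(2)
proof (induction R)
  case (add i R)
  then have "const (1 / of_nat i) * (y i * (N R * p)) \<in> K (Suc (n + size R)) (i + (w + sum_mset R))"
    by (intro K_const K_var) auto
  then show ?case by (simp add: z_def algebra_simps)
qed (simp add: assms(1))

lemma quadric_z:
  assumes "a + D + 4 \<le> d"
  shows "of_nat ((D + 3) * (a + 2) * (a + D + 2)) * (z (a + 2) * z (a + D + 2))
    - of_nat (2 * (D + 2) * (a + 1) * (a + D + 3)) * (z (a + 1) * z (a + D + 3))
    + of_nat (D + 1) * (y a * y (a + D + 4)) \<in> J"
proof -
  have "of_nat (D + 3) * y (a + 2) * y (a + D + 2)
      = of_nat ((D + 3) * (a + 2) * (a + D + 2)) * (z (a + 2) * z (a + D + 2))"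
    using y_eq[of "a + 2"] y_eq[of "a + D + 2"] by (simp only: of_nat_mult) (simp add: mult_ac)
  moreover have "2 * of_nat (D + 2) * y (a + 1) * y (a + D + 3)
      = of_nat (2 * (D + 2) * (a + 1) * (a + D + 3)) * (z (a + 1) * z (a + D + 3))"
    using y_eq[of "a + 1"] y_eq[of "a + D + 3"]
    by (simp only: of_nat_mult of_nat_numeral) (simp add: mult_ac)
  ultimately show ?thesis
    using quadric[OF assms] by (simp only: mult.assoc)
qed

text \<open>
  The coefficients of a quadric in the \<open>z i\<close> sum to zero, because the quadric vanishes at
  \<open>M\<^sub>i = i\<close>.
\<close>

lemma coefficient_identity:
  "(D + 3) * (a + 2) * (a + D + 2) + (D + 1) * (a * (a + D + 4))
    = 2 * (D + 2) * (a + 1) * (a + D + (3::nat))"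
  by (simp add: algebra_simps)

text \<open>
  Induction on \<open>i\<close>: by the quadric with leading indices \<open>i\<close> and \<open>j\<close>, the product \<open>z i * z j\<close> is an
  affine combination, with coefficients of sum \<open>1\<close>, of the products with first index \<open>i - 1\<close>
  and \<open>i - 2\<close>. When \<open>i = 2\<close>, the place of the last one is taken by a multiple of \<open>y 0\<close>, which is
  zero modulo \<open>K\<close>, and the coefficient of the other is \<open>1\<close>.
\<close>

lemma pair_first:
  assumes "0 < i" "i \<le> j" "i + j \<le> d"
  shows "z i * z j - z 1 * z (i + j - 1) \<in> K 1 (i + j)"
  using assms
proof (induction i arbitrary: j rule: less_induct)
  case (less i)
  show ?case
  proof (cases "i = 1")
    case True
    then show ?thesis by (simp add: J_in_K J_0)
  next
    case False
    define a D where "a = i - 2" and "D = j - i"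
    have ij: "i = a + 2" "j = a + D + 2" using less.prems False by (auto simp: a_def D_def)
    define t where "t = z 1 * z (i + j - 1)"
    have s: "(a + 1) + (a + D + 3) = i + j" "a + (a + D + 4) = i + j" using ij by simp_all
    \<comment> \<open>\<open>U\<close> and \<open>T\<close> replace the two lower products in the quadric by multiples of \<open>t\<close>.\<close>
    have U: "z (a + 1) * z (a + D + 3) - t \<in> K 1 (i + j)"
      using less.IH[of "a + 1" "a + D + 3"] less.prems unfolding s t_def by (simp add: ij)
    have T: "y a * y (a + D + 4) - of_nat (a * (a + D + 4)) * t \<in> K 1 (i + j)"
    proof (cases "a = 0")
      case True
      have "const 1 * (\<Prod>i\<in>#{#D + 4#}. y i) \<in> bihom d const y 1 (i + j)"
        using less.prems by (intro bihom_term) (auto simp: ij True)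
      then show ?thesis using K_I[OF J_0, of "y (D + 4)"] True
        by (simp add: const_1)
    next
      case False
      have "z a * z (a + D + 4) - t \<in> K 1 (i + j)"
        using less.IH[of a "a + D + 4"] less.prems False unfolding s t_def by (simp add: ij)
      then have "of_nat (a * (a + D + 4)) * (z a * z (a + D + 4) - t) \<in> K 1 (i + j)"
        by (rule K_of_nat)
      moreover have "y a * y (a + D + 4) = of_nat (a * (a + D + 4)) * (z a * z (a + D + 4))"
        using y_eq[of a] y_eq[of "a + D + 4"] False by (simp only: of_nat_mult) (simp add: mult_ac)
      ultimately show ?thesis by (simp only: right_diff_distrib)
    qed
    define A B E where "A = (D + 3) * (a + 2) * (a + D + 2)" and
      "B = 2 * (D + 2) * (a + 1) * (a + D + 3)" and "E = a * (a + D + 4)"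
    have AB: "of_nat A + of_nat (D + 1) * of_nat E = (of_nat B :: 'a)"
      using coefficient_identity[of D a] unfolding A_def B_def E_def by (metis of_nat_add of_nat_mult)
    have "of_nat A * (z i * z j) - of_nat B * (z (a + 1) * z (a + D + 3))
        + of_nat (D + 1) * (y a * y (a + D + 4)) \<in> J" (is "?Q \<in> J")
      unfolding ij A_def B_def by (rule quadric_z) (use less.prems ij in auto)
    then have "?Q + of_nat B * (z (a + 1) * z (a + D + 3) - t)
        - of_nat (D + 1) * (y a * y (a + D + 4) - of_nat E * t) \<in> K 1 (i + j)"
      by (intro K_diff[OF K_add[OF J_in_K K_of_nat[OF U]] K_of_nat[OF T[folded E_def]]])
    also have "?Q + of_nat B * (z (a + 1) * z (a + D + 3) - t)
        - of_nat (D + 1) * (y a * y (a + D + 4) - of_nat E * t)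
      = of_nat A * (z i * z j - t)"
      unfolding AB[symmetric] by (simp add: algebra_simps)
    finally show ?thesis unfolding t_def
      by (rule K_cancel) (simp add: A_def)
  qed
qed

lemma pair:
  assumes "0 < i" "0 < j" "0 < k" "0 < l" "i + j = k + l" "i + j \<le> d"
  shows "z i * z j - z k * z l \<in> K 1 (i + j)"
proof -
  have first: "z i * z j - z 1 * z (i + j - 1) \<in> K 1 (i + j)"
    if "0 < i" "0 < j" "i + j \<le> d" for i j
    using pair_first[of i j] pair_first[of j i] that
    by (cases "i \<le> j") (simp_all add: add.commute mult.commute)
  show ?thesis
    using K_diff[OF first[of i j] first[of k l, folded assms(5)]] assms by simp
qed

lemma pair_N:
  assumes "0 < i" "0 < j" "0 < k" "0 < l" "i + j = k + l" "i + j \<le> d"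
    and R: "set_mset R \<subseteq> {1..d}" and n: "n = Suc (size R)" and w: "w = i + j + sum_mset R"
  shows "N (R + {#i, j#}) - N (R + {#k, l#}) \<in> K n w"
  using K_N[OF pair[OF assms(1-6)] R] by (simp add: n w algebra_simps)

text \<open>
  Induction on the sum of squares. Let \<open>e\<close> be the least and \<open>l\<close> the greatest entry of a multiset
  that is not balanced. It suffices to bring them closer, to \<open>e + 1\<close> and \<open>l - 1\<close>.

  If \<open>e + l \<le> d\<close>, this is an instance of \<open>pair\<close>. If \<open>e + l > d\<close> but \<open>l < d\<close>, let \<open>f\<close> be the next
  smallest entry; since \<open>2 w \<le> (n + 1) d\<close>, one has \<open>e + f < d\<close>, and the exchanges
  \<open>(e, f, l) \<rightarrow> (1, e + f - 1, l) \<rightarrow> (2, e + f - 1, l - 1) \<rightarrow> (e + 1, f, l - 1)\<close> all concern pairs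
  with sum at most \<open>d\<close>. If \<open>l = d\<close>, the exchange of \<open>1\<close> and \<open>d\<close> is not available. Then the
  quadric on \<open>(e, d)\<close>, \<open>(e + 1, d - 1)\<close>, \<open>(e + 2, d - 2)\<close> expresses the monomial as an affine
  combination of two monomials with smaller sums of squares. It exists because \<open>2 e < d\<close> and
  \<open>d \<ge> 6\<close> give \<open>e + 4 \<le> d\<close>.
\<close>

lemma N_balanced:
  assumes "set_mset M \<subseteq> {1..d}" "size M = Suc n" "sum_mset M = w" "2 * w \<le> Suc n * d"
  shows "N M - N (balanced_mset (Suc n) w) \<in> K n w"
  using assms
proof (induction "\<Sum>i\<in>#M. i * i" arbitrary: M rule: less_induct)
  case less
  let ?B = "balanced_mset (Suc n) w"
  define e l where "e = Min (set_mset M)" and "l = Max (set_mset M)"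
  have ne: "set_mset M \<noteq> {}" using less.prems by auto
  have e: "e \<in># M" "\<And>x. x \<in># M \<Longrightarrow> e \<le> x" and l: "l \<in># M" "\<And>x. x \<in># M \<Longrightarrow> x \<le> l"
    unfolding e_def l_def using Min_in[of "set_mset M"] Max_in[of "set_mset M"] ne by simp_all
  have "e \<in> {1..d}" "l \<in> {1..d}" using e(1) l(1) less.prems(1) by blast+
  then have range: "0 < e" "e \<le> l" "l \<le> d" using e(2)[OF l(1)] by simp_all
  show ?case
  proof (cases "l \<le> Suc e")
    case True
    have "M = balanced_mset (size M) (sum_mset M)"
    proof (rule eq_balanced_mset[OF e(1)])
      show "x = e \<or> x = Suc e" if "x \<in># M" for x
        using e(2)[OF that] l(2)[OF that] True by linarith
    qed
    then have "M = ?B" using less.prems(2,3) by simp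
    then show ?thesis by (simp add: J_in_K J_0)
  next
    case False
    then have gap: "e + 2 \<le> l" by simp
    obtain M1 where M1: "M = add_mset e M1" using e(1) by (metis insert_DiffM)
    have "l \<in># M1" using l(1) gap by (simp add: M1)
    then obtain R where "M1 = add_mset l R" by (metis insert_DiffM)
    with M1 have M: "M = R + {#e, l#}" by simp
    have eR: "e \<le> x" if "x \<in># R" for x
      by (rule e(2)) (use that M in simp)
    have R: "set_mset R \<subseteq> {1..d}" "n = Suc (size R)" "w = e + l + sum_mset R"
      using less.prems(1-3) unfolding M by simp_all
    have IH: "N (R' + {#a, b#}) - N ?B \<in> K n w"
      if "e < a" "e < b" "a < l" "b < l" "a + b = e + l" "R' = R" for a b R'
    proof -
      define u where "u = a - e"
      have u: "a = e + u" and lb: "l = b + u" using that(1,5) by (simp_all add: u_def)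
      have "a * a + b * b < e * e + l * l"
      proof -
        \<comment> \<open>Moving both entries inwards by \<open>u\<close> lowers the sum of squares by \<open>2 u (b - e)\<close>.\<close>
        have "0 < u" using that(1) by (simp add: u_def)
        moreover have "e < b" by fact
        ultimately have "u * e < u * b" by simp
        then show ?thesis unfolding u lb distrib_left distrib_right by (simp only: mult.commute)
      qed
      show ?thesis
        unfolding that(6)
      proof (intro less.hyps)
        show "(\<Sum>i\<in>#R + {#a, b#}. i * i) < (\<Sum>i\<in>#M. i * i)"
          using \<open>a * a + b * b < e * e + l * l\<close> by (simp add: M)
        show "set_mset (R + {#a, b#}) \<subseteq> {1..d}"
          using R(1) that range by simp
        show "size (R + {#a, b#}) = Suc n" "sum_mset (R + {#a, b#}) = w"
          using R(2,3) that(5) by simp_all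
      qed (fact less.prems(4))
    qed
    consider (top) "l = d" | (low) "l < d" "e + l \<le> d" | (high) "l < d" "e + l > d"
      using range by linarith
    then show ?thesis
    proof cases
      case top
      have "size R * e \<le> sum_mset R" using eR by (rule sum_mset_ge_size_mult)
      \<comment> \<open>All entries are at least \<open>e\<close> and one is \<open>d\<close>, so a mean of at most \<open>d / 2\<close> forces \<open>2 e < d\<close>.\<close>
      then have "2 * (e + d + size R * e) \<le> Suc n * d"
        using less.prems(4) R(2,3) top by simp
      then have "Suc (size R) * (2 * e) \<le> size R * d"
        by (simp add: R(2) algebra_simps)
      also have "\<dots> < Suc (size R) * d" using d_ge by simp
      finally have "2 * e < d" by (simp only: mult_less_cancel1)
      define D where "D = d - 4 - e"
      have D: "d = e + D + 4" using \<open>2 * e < d\<close> d_ge by (simp add: D_def)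
      define A B E where "A = (D + 3) * (e + 2) * (e + D + 2)" and
        "B = 2 * (D + 2) * (e + 1) * (e + D + 3)" and "E = (D + 1) * (e * (e + D + 4))"
      have AB: "of_nat A + of_nat E = (of_nat B :: 'a)"
        using coefficient_identity[of D e] unfolding A_def B_def E_def by (metis of_nat_add)
      have "of_nat (D + 1) * (y e * y (e + D + 4)) = of_nat E * (z e * z (e + D + 4))"
        using y_eq[of e] y_eq[of "e + D + 4"] range
        unfolding E_def by (simp only: of_nat_mult) (simp add: mult_ac)
      then have "of_nat A * (z (e + 2) * z (e + D + 2)) - of_nat B * (z (e + 1) * z (e + D + 3))
          + of_nat E * (z e * z (e + D + 4)) \<in> J" (is "?Q \<in> J")
        using quadric_z[of e D] D unfolding A_def B_def by simp
      then have Q: "N R * ?Q \<in> K n w"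
        using K_N[OF J_in_K[of ?Q 1 "e + l"] R(1)] by (simp add: R(2,3))
      have 1: "N (R + {#e + 1, e + D + 3#}) - N ?B \<in> K n w"
        by (rule IH) (use top D gap in auto)
      have 2: "N (R + {#e + 2, e + D + 2#}) - N ?B \<in> K n w"
        by (rule IH) (use top D gap in auto)
      have "N R * ?Q + of_nat B * (N (R + {#e + 1, e + D + 3#}) - N ?B)
          - of_nat A * (N (R + {#e + 2, e + D + 2#}) - N ?B) \<in> K n w"
        by (rule K_diff[OF K_add[OF Q K_of_nat[OF 1]] K_of_nat[OF 2]])
      also have "N R * ?Q + of_nat B * (N (R + {#e + 1, e + D + 3#}) - N ?B)
          - of_nat A * (N (R + {#e + 2, e + D + 2#}) - N ?B) = of_nat E * (N M - N ?B)"
        unfolding AB[symmetric] M top D by (simp add: algebra_simps)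
      finally show ?thesis
        by (rule K_cancel) (use range in \<open>simp add: E_def\<close>)
    next
      case low
      have "N (R + {#e, l#}) - N (R + {#e + 1, l - 1#}) \<in> K n w"
        using low range gap R by (intro pair_N) auto
      moreover have "N (R + {#e + 1, l - 1#}) - N ?B \<in> K n w"
        by (rule IH) (use gap in auto)
      ultimately have "(N (R + {#e, l#}) - N (R + {#e + 1, l - 1#}))
          + (N (R + {#e + 1, l - 1#}) - N ?B) \<in> K n w"
        by (rule K_add)
      then show ?thesis unfolding M by (simp only: diff_add_cancel add_diff_eq)
    next
      case high
      have "R \<noteq> {#}" using less.prems(4) high by (auto simp: R(2,3))
      then have "set_mset R \<noteq> {}" by simp
      define f where "f = Min (set_mset R)"
      have f: "f \<in># R" "\<And>x. x \<in># R \<Longrightarrow> f \<le> x"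
        unfolding f_def using \<open>set_mset R \<noteq> {}\<close> by auto
      have ef: "e \<le> f" using eR f(1) .
      have "e + f < d"
      proof (rule ccontr)
        assume "\<not> e + f < d"
        \<comment> \<open>Otherwise \<open>e + l > d\<close> and all other entries are at least \<open>d / 2\<close>: the mean exceeds \<open>d / 2\<close>.\<close>
        then have "d \<le> 2 * f" using ef by simp
        then have "size R * d \<le> 2 * (size R * f)" by (metis mult.left_commute mult_le_mono2)
        also have "size R * f \<le> sum_mset R" using f(2) by (rule sum_mset_ge_size_mult)
        finally have "size R * d \<le> 2 * sum_mset R" by simp
        then show False using less.prems(4) high by (simp add: R(2,3))
      qed
      obtain S where S: "R = add_mset f S" using f(1) by (metis insert_DiffM)
      have Sd: "set_mset S \<subseteq> {1..d}" and fd: "0 < f" "f \<le> d" using R(1) S by auto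
      have n: "n = Suc (Suc (size S))" and w: "w = e + l + f + sum_mset S"
        using R(2,3) by (simp_all add: S)
      define g where "g = e + f - 1"
      have g: "0 < g" "g < d" "e + f = Suc g" using range fd \<open>e + f < d\<close> by (auto simp: g_def)
      have 1: "N (add_mset l S + {#e, f#}) - N (add_mset l S + {#1, g#}) \<in> K n w"
        using range fd Sd n w \<open>e + f < d\<close> g by (intro pair_N) auto
      have 2: "N (add_mset g S + {#1, l#}) - N (add_mset g S + {#2, l - 1#}) \<in> K n w"
        using range Sd n w high g gap by (intro pair_N) auto
      have 3: "N (add_mset (l - 1) S + {#2, g#}) - N (add_mset (l - 1) S + {#e + 1, f#}) \<in> K n w"
        using range fd Sd n w \<open>e + f < d\<close> g gap by (intro pair_N) auto
      have 4: "N (R + {#e + 1, l - 1#}) - N ?B \<in> K n w"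
        by (rule IH) (use gap in auto)
      have "(N (add_mset l S + {#e, f#}) - N (add_mset l S + {#1, g#}))
          + (N (add_mset g S + {#1, l#}) - N (add_mset g S + {#2, l - 1#}))
          + (N (add_mset (l - 1) S + {#2, g#}) - N (add_mset (l - 1) S + {#e + 1, f#}))
          + (N (R + {#e + 1, l - 1#}) - N ?B) \<in> K n w" (is "?sum \<in> _")
        by (intro K_add 1 2 3 4)
      also have "?sum = N M - N ?B"
        unfolding M S by (simp add: mult_ac)
      finally show ?thesis .
    qed
  qed
qed

text \<open>
  Monomials that contain \<open>y 0\<close> contribute nothing modulo \<open>K n w\<close> and nothing to \<open>ev 0\<close>; all
  others are congruent to multiples of one and the same element, the factor being their value
  under \<open>ev 0\<close>.
\<close>

lemma eliminate_first_variable: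
  assumes p: "p \<in> bihom d const y (Suc n) w" and w: "2 * w \<le> Suc n * d" and ev: "ev 0 p = 0"
  shows "p \<in> K n w"
proof -
  let ?B = "N (balanced_mset (Suc n) w)"
  have "p - const (ev 0 p) * ?B \<in> K n w"
    using p
  proof (induction rule: bihom.induct)
    case zero
    then show ?case by (simp add: ev_0 const_0 J_in_K J_0)
  next
    case (add_term M p c)
    have "const c * (\<Prod>i\<in>#M. y i) - const (ev 0 (const c * (\<Prod>i\<in>#M. y i))) * ?B \<in> K n w"
    proof (cases "0 \<in># M")
      case True
      then obtain M' where M': "M = add_mset 0 M'" by (metis insert_DiffM)
      have "0 + y 0 * (const c * (\<Prod>i\<in>#M'. y i)) \<in> K n w"
        using add_term.hyps by (intro K_I J_0 bihom_term) (auto simp: M')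
      moreover have "ev 0 (const c * (\<Prod>i\<in>#M. y i)) = 0"
        by (simp add: M' ev_mult ev_var)
      ultimately show ?thesis by (simp add: M' const_0 algebra_simps)
    next
      case False
      have sub: "set_mset M \<subseteq> {1..d}"
      proof
        fix x assume "x \<in># M"
        with False add_term.hyps(1) show "x \<in> {1..d}" by (cases x) auto
      qed
      have "(\<Prod>i\<in>#M. 0 + of_nat i) = (of_nat (prod_mset M) :: 'k)"
        by (induction M) simp_all
      then have "ev 0 (const c * (\<Prod>i\<in>#M. y i)) = c * of_nat (prod_mset M)"
        using add_term.hyps by (simp add: ev_mult ev_const ev_monom)
      then have "const c * (\<Prod>i\<in>#M. y i) - const (ev 0 (const c * (\<Prod>i\<in>#M. y i))) * ?B
         = const c * (of_nat (prod_mset M) * (N M - ?B))"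
        by (simp add: monom_eq_N[OF False] const_mult const_of_nat algebra_simps)
      also have "\<dots> \<in> K n w"
        using sub add_term.hyps w by (intro K_const K_of_nat N_balanced) auto
      finally show ?thesis .
    qed
    from K_add[OF this add_term.IH] show ?case
      by (simp add: ev_add const_add algebra_simps)
  qed
  then show ?thesis by (simp add: ev const_0)
qed

lemma ev_is_poly:
  "p \<in> bihom d const y n w \<Longrightarrow> \<exists>E. \<forall>x. ev x p = poly E x"
proof (induction rule: bihom.induct)
  case zero
  show ?case by (rule exI[of _ 0]) (simp add: ev_0)
next
  case (add_term M p c)
  then obtain E where E: "\<forall>x. ev x p = poly E x" by blast
  have "(\<Prod>i\<in>#M. x + of_nat i) = poly (\<Prod>i\<in>#M. [:of_nat i, 1:]) x" for x :: 'k
    by (induction M) (simp_all add: algebra_simps)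
  then have "\<forall>x. ev x (const c * (\<Prod>i\<in>#M. y i) + p) = poly (smult c (\<Prod>i\<in>#M. [:of_nat i, 1:]) + E) x"
    using E add_term.hyps by (simp add: ev_add ev_mult ev_const ev_monom)
  then show ?case by blast
qed

text \<open>
  Values outside \<open>x = 0\<close> suffice. This permits dividing by \<open>x\<close>, the value of \<open>y 0\<close>.
\<close>

lemma ev_eq_0:
  assumes "p \<in> bihom d const y n w" "\<And>x. x \<noteq> 0 \<Longrightarrow> ev x p = 0"
  shows "ev x p = 0"
proof -
  obtain E where E: "\<forall>x. ev x p = poly E x" using ev_is_poly[OF assms(1)] by blast
  have "E = 0"
    by (rule poly_eq_0_if_zero_off_0) (use assms(2) E in metis)
  then show ?thesis using E by simp
qed

text \<open>
  The sign in \<open>- y (d - i)\<close> makes the substituted values increase with \<open>i\<close> again: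
  \<open>- ((- x - d) + (d - i)) = x + i\<close>. The quadrics are permuted: \<open>f\<^bsub>i,j\<^esub>\<close> becomes
  \<open>f\<^bsub>d-j,d-i\<^esub>\<close>, and the signs cancel because the degree is even.
\<close>

lemma reflected: "quadric_sequence d const J (\<lambda>i. - y (d - i)) (\<lambda>x. ev (- x - of_nat d))"
proof
  fix a D assume aD: "a + D + 4 \<le> d"
  define b where "b = d - (a + D + 4)"
  have "d - (a + 2) = b + D + 2" "d - (a + D + 2) = b + 2" "d - (a + 1) = b + D + 3"
    "d - (a + D + 3) = b + 1" "d - a = b + D + 4" "d - (a + D + 4) = b"
    using aD by (auto simp: b_def)
  moreover have "b + D + 4 \<le> d" using aD by (simp add: b_def)
  ultimately show "of_nat (D + 3) * - y (d - (a + 2)) * - y (d - (a + D + 2))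
     - 2 * of_nat (D + 2) * - y (d - (a + 1)) * - y (d - (a + D + 3))
     + of_nat (D + 1) * - y (d - a) * - y (d - (a + D + 4)) \<in> J"
    using quadric[of b D] by (simp only:) (simp add: mult_ac)
next
  show "- y (d - i) * p \<in> J" if "i \<le> d" "p \<in> J" for i p
    using J_const[OF J_var[of "d - i" p], of "- 1"] that by (simp add: const_neg_1)
next
  fix x i assume i: "i \<le> d"
  have "ev (- x - of_nat d) (- y (d - i)) = ev (- x - of_nat d) (const (- 1) * y (d - i))"
    by (simp add: const_neg_1)
  also have "\<dots> = x + of_nat i"
    using i unfolding ev_mult ev_const by (simp add: ev_var of_nat_diff)
  finally show "ev (- x - of_nat d) (- y (d - i)) = x + of_nat i" .
qed (simp_all add: d_ge const_add const_mult const_1 J_0 J_add J_const ev_add ev_mult ev_const ev_J)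

lemma bihom_reflected:
  assumes "p \<in> bihom d const y n w"
  shows "p \<in> bihom d const (\<lambda>i. - y (d - i)) n (n * d - w)"
  using assms
proof (induction rule: bihom.induct)
  case (add_term M p c)
  \<comment> \<open>The conjunction adds the weights of the two multisets, to avoid subtraction in the induction.\<close>
  have *: "(\<Prod>i\<in>#M. y i) = const ((- 1) ^ size M) * (\<Prod>i\<in>#image_mset ((-) d) M. - y (d - i))
      \<and> sum_mset M + sum_mset (image_mset ((-) d) M) = size M * d"
    using add_term.hyps(1)
    by (induction M) (simp_all add: const_1 const_uminus algebra_simps)
  have "const (c * (- 1) ^ size M) * (\<Prod>i\<in>#image_mset ((-) d) M. - y (d - i)) + p
      \<in> bihom d const (\<lambda>i. - y (d - i)) n (n * d - w)"
    using add_term * by (intro bihom.add_term) auto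
  then show ?case using * by (simp add: const_mult mult.assoc)
qed (rule bihom.zero)

end

text \<open>
  One of \<open>w\<close> and \<open>n d - w\<close> is at most half of \<open>n d\<close>, so \<open>y 0\<close> can be split off either from the given
  sequence or from the reflected one.
\<close>

theorem bihom_kernel_subset:
  assumes "quadric_sequence d const J y ev" "p \<in> bihom d const y n w" "\<And>x. ev x p = 0"
  shows "p \<in> J"
  using assms
proof (induction n arbitrary: y ev p w)
  case 0
  interpret quadric_sequence d const J y ev by fact
  from 0(2) have "\<exists>c. p = const c"
  proof (induction rule: bihom.induct)
    case (add_term M p c)
    then show ?case by (metis const_add image_mset_empty mult.right_neutral prod_mset_empty size_eq_0_iff_empty)
  qed (metis const_0)
  then show ?case using 0(3) by (metis J_0 const_0 ev_const)
next
  case (Suc n)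
  have half: "p \<in> J"
    if qs: "quadric_sequence d const J y ev" and p: "p \<in> bihom d const y (Suc n) w"
      and ev: "\<And>x. ev x p = 0" and w: "2 * w \<le> Suc n * d" for y ev p w
  proof -
    interpret quadric_sequence d const J y ev by fact
    obtain j q where jq: "j \<in> J" "q \<in> bihom d const y n w" "p = j + y 0 * q"
      using eliminate_first_variable[OF p w ev] unfolding K_def by blast
    have "ev x q = 0" for x
    proof (rule ev_eq_0[OF jq(2)])
      fix x :: 'a assume "x \<noteq> 0"
      have "x * ev x q = 0"
        using ev[of x] jq(1,3) by (simp add: ev_add ev_mult ev_var ev_J)
      then show "ev x q = 0" using \<open>x \<noteq> 0\<close> by simp
    qed
    then have "q \<in> J" using Suc.IH[OF qs jq(2)] by simp
    then show ?thesis using jq by (simp add: J_add J_var)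
  qed
  interpret quadric_sequence d const J y ev by fact
  show ?case
  proof (cases "2 * w \<le> Suc n * d")
    case True
    then show ?thesis using half[OF Suc.prems] by blast
  next
    case False
    then have "2 * (Suc n * d - w) \<le> Suc n * d" by linarith
    then show ?thesis
      by (rule half[OF reflected bihom_reflected[OF Suc.prems(2)] Suc.prems(3)])
  qed
qed

section \<open>Evaluation of polynomials\<close>

lemma mvpoly_eval_add: "mvpoly_eval v (p + q) = mvpoly_eval v p + mvpoly_eval v q"
  unfolding mvpoly_eval_def by (rule setsum_keys_plus_distrib) (simp_all add: distrib_right)

lemma mvpoly_eval_single:
  "mvpoly_eval v (Poly_Mapping.single m a) = a * (\<Prod>i\<in>Poly_Mapping.keys m. v i ^ Poly_Mapping.lookup m i)"
  by (simp add: mvpoly_eval_def)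

lemma mvpoly_eval_sum: "mvpoly_eval v (sum f A) = (\<Sum>x\<in>A. mvpoly_eval v (f x))"
  by (induction A rule: infinite_finite_induct) (simp_all add: mvpoly_eval_add, simp_all add: mvpoly_eval_def)

lemma sum_single_lookup: "(\<Sum>m\<in>Poly_Mapping.keys p. Poly_Mapping.single m (Poly_Mapping.lookup p m)) = p"
  by (rule poly_mapping_eqI) (auto simp: lookup_sum lookup_single when_def in_keys_iff sum.delta)

lemma mvpoly_eval_mult: "mvpoly_eval v (p * q) = mvpoly_eval v p * mvpoly_eval v q"
proof -
  let ?e = "\<lambda>m. \<Prod>i\<in>Poly_Mapping.keys m. v i ^ Poly_Mapping.lookup m i"
  have e: "?e (a + b) = ?e a * ?e b" for a b
  proof -
    let ?S = "Poly_Mapping.keys a \<union> Poly_Mapping.keys b"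
    have "?e m = (\<Prod>i\<in>?S. v i ^ Poly_Mapping.lookup m i)" if "Poly_Mapping.keys m \<subseteq> ?S" for m
      using that by (intro prod.mono_neutral_left) (auto simp: in_keys_iff)
    from this[of "a + b"] this[of a] this[of b] show ?thesis
      using Poly_Mapping.keys_add[of a b] by (simp add: lookup_add power_add prod.distrib)
  qed
  have "p * q = (\<Sum>a\<in>Poly_Mapping.keys p. \<Sum>b\<in>Poly_Mapping.keys q.
      Poly_Mapping.single (a + b) (Poly_Mapping.lookup p a * Poly_Mapping.lookup q b))"
    using sum_product[of "\<lambda>m. Poly_Mapping.single m (Poly_Mapping.lookup p m)" "Poly_Mapping.keys p"
        "\<lambda>m. Poly_Mapping.single m (Poly_Mapping.lookup q m)" "Poly_Mapping.keys q"]
    by (simp only: sum_single_lookup mult_single)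
  then have "mvpoly_eval v (p * q) = (\<Sum>a\<in>Poly_Mapping.keys p. \<Sum>b\<in>Poly_Mapping.keys q.
      (Poly_Mapping.lookup p a * ?e a) * (Poly_Mapping.lookup q b * ?e b))"
    by (simp add: mvpoly_eval_sum mvpoly_eval_single e mult_ac)
  then show ?thesis by (simp only: sum_product mvpoly_eval_def)
qed

lemma mvpoly_eval_const [simp]: "mvpoly_eval v (Poly_Mapping.single 0 c) = c"
  by (simp add: mvpoly_eval_single)

lemma mvpoly_eval_mvar [simp]: "mvpoly_eval v (mvar i) = v i"
  by (simp add: mvar_def mvpoly_eval_single)

lemma mvpoly_eval_of_nat [simp]: "mvpoly_eval v (of_nat n) = of_nat n"
  using mvpoly_eval_const[of v "of_nat n"] by (simp only: single_of_nat)

lemma mvpoly_eval_uminus: "mvpoly_eval v (- p) = - mvpoly_eval v p"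
  using mvpoly_eval_add[of v p "- p"] by (simp add: eq_neg_iff_add_eq_0 add.commute) (simp add: mvpoly_eval_def)

lemma mvpoly_eval_moment_poly:
  "mvpoly_eval v (moment_poly i j) = of_nat (j - i + 3) * v i * v j
     - 2 * of_nat (j - i + 2) * v (i - 1) * v (j + 1) + of_nat (j - i + 1) * v (i - 2) * v (j + 2)"
proof -
  have two: "2 * of_nat (j - i + 2) = of_nat (2 * (j - i + 2))" for j i
    by (simp only: of_nat_mult of_nat_numeral)
  show ?thesis
    unfolding moment_poly_def two diff_conv_add_uminus
    by (simp only: mvpoly_eval_add mvpoly_eval_mult mvpoly_eval_uminus mvpoly_eval_of_nat mvpoly_eval_mvar)
qed

section \<open>The ideal of the quadrics\<close>

lemma ideal_mvpoly_eval_0: "ideal {p \<in> carrier (mvpoly_ring d). mvpoly_eval v p = 0} (mvpoly_ring d)"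
proof -
  interpret R: cring "mvpoly_ring d :: 'a mvpoly ring" by (rule cring_mvpoly_ring)
  have minus: "\<ominus>\<^bsub>mvpoly_ring d\<^esub> p = - p" if "mvars p \<subseteq> {..d}" for p :: "'a mvpoly"
    by (rule R.minus_equality) (use that in simp_all)
  show ?thesis
  proof (rule idealI)
    show "subgroup {p \<in> carrier (mvpoly_ring d). mvpoly_eval v p = 0} (add_monoid (mvpoly_ring d))"
    proof (rule R.add.subgroupI)
      show "{p \<in> carrier (mvpoly_ring d). mvpoly_eval v p = 0} \<noteq> {}"
        by (auto simp: mvpoly_eval_def intro!: exI[of _ 0])
    next
      fix p q :: "'a mvpoly"
      assume "p \<in> {p \<in> carrier (mvpoly_ring d). mvpoly_eval v p = 0}"
        "q \<in> {p \<in> carrier (mvpoly_ring d). mvpoly_eval v p = 0}"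
      then show "p \<oplus>\<^bsub>mvpoly_ring d\<^esub> q \<in> {p \<in> carrier (mvpoly_ring d). mvpoly_eval v p = 0}"
        using mvars_add[of p q] by (auto simp: mvpoly_eval_add)
    qed (auto simp: minus mvpoly_eval_uminus)
  next
    fix p q :: "'a mvpoly"
    assume "p \<in> {p \<in> carrier (mvpoly_ring d). mvpoly_eval v p = 0}" "q \<in> carrier (mvpoly_ring d)"
    then show "q \<otimes>\<^bsub>mvpoly_ring d\<^esub> p \<in> {p \<in> carrier (mvpoly_ring d). mvpoly_eval v p = 0}"
      "p \<otimes>\<^bsub>mvpoly_ring d\<^esub> q \<in> {p \<in> carrier (mvpoly_ring d). mvpoly_eval v p = 0}"
      using mvars_mult[of p q] by (auto simp: mvpoly_eval_mult mult.commute)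
  qed (rule R.ring_axioms)
qed

lemma moment_gens_subset:
  "{moment_poly i j | i j. 2 \<le> i \<and> i \<le> j \<and> j \<le> d - 2}
    \<subseteq> carrier (mvpoly_ring d :: 'k::field mvpoly ring)"
  using moment_poly_in_carrier by blast

lemma ideal_moment_poly_ideal: "ideal (moment_poly_ideal d :: 'k::field mvpoly set) (mvpoly_ring d)"
proof -
  interpret R: cring "mvpoly_ring d :: 'k mvpoly ring" by (rule cring_mvpoly_ring)
  show ?thesis unfolding moment_poly_ideal_def by (rule R.genideal_ideal[OF moment_gens_subset])
qed

lemma moment_poly_in_ideal:
  assumes "2 \<le> i" "i \<le> j" "j \<le> d - 2"
  shows "moment_poly i j \<in> (moment_poly_ideal d :: 'k::field mvpoly set)"
proof -
  interpret R: cring "mvpoly_ring d :: 'k mvpoly ring" by (rule cring_mvpoly_ring)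
  show ?thesis
    unfolding moment_poly_ideal_def using R.genideal_self[OF moment_gens_subset] assms by blast
qed

text \<open>
  On \<open>v\<^sub>i = x + i\<close> the products \<open>v\<^sub>i v\<^sub>j\<close> with \<open>i + j\<close> fixed are affine functions of \<open>i j\<close>. The
  coefficients of the quadric are the ones of the linear relation between three points on a line.
\<close>

lemma moment_poly_arithmetic_progression:
  assumes "2 \<le> i" "i \<le> j"
  shows "mvpoly_eval (\<lambda>i. x + of_nat i) (moment_poly i j) = (0 :: 'k::field)"
proof -
  obtain a where a: "i = a + 2" using assms(1) by (metis add.commute le_Suc_ex)
  obtain D where D: "j = a + 2 + D" using assms(2) a le_Suc_ex by blast
  show ?thesis unfolding mvpoly_eval_moment_poly by (simp add: a D algebra_simps)
qed

lemma quadric_sequence_mvar: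
  assumes "6 \<le> d"
  shows "quadric_sequence d (Poly_Mapping.single 0) (moment_poly_ideal d :: 'k::field_char_0 mvpoly set)
    mvar (\<lambda>x. mvpoly_eval (\<lambda>i. x + of_nat i))"
proof -
  interpret R: cring "mvpoly_ring d :: 'k mvpoly ring" by (rule cring_mvpoly_ring)
  interpret J: ideal "moment_poly_ideal d :: 'k mvpoly set" "mvpoly_ring d"
    by (rule ideal_moment_poly_ideal)
  have mult: "p * q \<in> moment_poly_ideal d" if "q \<in> moment_poly_ideal d" "mvars p \<subseteq> {..d}"
    for p q :: "'k mvpoly"
    using J.I_l_closed[of q p] that by simp
  show ?thesis
  proof
    show "0 \<in> (moment_poly_ideal d :: 'k mvpoly set)" using J.zero_closed by simp
    show "p + q \<in> moment_poly_ideal d" if "p \<in> moment_poly_ideal d" "q \<in> moment_poly_ideal d"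
      for p q :: "'k mvpoly"
      using J.a_closed[of p q] that by simp
    show "Poly_Mapping.single 0 c * p \<in> moment_poly_ideal d" if "p \<in> moment_poly_ideal d"
      for c and p :: "'k mvpoly"
      by (rule mult[OF that]) (simp add: mvars_def)
    show "mvar i * p \<in> moment_poly_ideal d" if "i \<le> d" "p \<in> moment_poly_ideal d"
      for i and p :: "'k mvpoly"
      by (rule mult[OF that(2)]) (use mvars_mvar[of i, where 'a = 'k] that(1) in auto)
    show "of_nat (D + 3) * mvar (a + 2) * mvar (a + D + 2)
       - 2 * of_nat (D + 2) * mvar (a + 1) * mvar (a + D + 3)
       + of_nat (D + 1) * mvar a * mvar (a + D + 4) \<in> (moment_poly_ideal d :: 'k mvpoly set)"
      if "a + D + 4 \<le> d" for a D
    proof -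
      have ix: "a + D + 2 - (a + 2) = D" "a + 2 - 1 = a + 1" "a + D + 2 + 1 = a + D + 3" "a + 2 - 2 = a"
        "a + D + 2 + 2 = a + D + 4" by simp_all
      show ?thesis
        using moment_poly_in_ideal[of "a + 2" "a + D + 2" d, where 'k = 'k] that
        unfolding moment_poly_def ix by simp
    qed
    show "mvpoly_eval (\<lambda>i. x + of_nat i) p = 0" if "p \<in> moment_poly_ideal d" for x and p :: "'k mvpoly"
    proof -
      have "moment_poly_ideal d \<subseteq> {p \<in> carrier (mvpoly_ring d). mvpoly_eval (\<lambda>i. x + of_nat i) p = 0}"
        unfolding moment_poly_ideal_def
        by (rule R.genideal_minimal[OF ideal_mvpoly_eval_0])
           (use moment_gens_subset moment_poly_arithmetic_progression in blast)
      then show ?thesis using that by blast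
    qed
  qed (simp_all add: assms single_add mult_single mvpoly_eval_add mvpoly_eval_mult)
qed

section \<open>Monomials as multisets of indices\<close>

definition mset_of_exponents :: "(nat \<Rightarrow>\<^sub>0 nat) \<Rightarrow> nat multiset" where
  "mset_of_exponents m = (\<Sum>i\<in>Poly_Mapping.keys m. replicate_mset (Poly_Mapping.lookup m i) i)"

lemma set_mset_of_exponents: "set_mset (mset_of_exponents m) = Poly_Mapping.keys m"
  unfolding mset_of_exponents_def by (auto simp: set_mset_sum in_keys_iff split: if_splits)

lemma prod_mset_of_exponents:
  "(\<Prod>i\<in>#mset_of_exponents m. v i) = (\<Prod>i\<in>Poly_Mapping.keys m. v i ^ Poly_Mapping.lookup m i)"
proof -
  have "(\<Prod>i\<in>#(\<Sum>i\<in>A. replicate_mset (f i) i). v i) = (\<Prod>i\<in>A. v i ^ f i)" for A and f :: "nat \<Rightarrow> nat"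
    by (induction A rule: infinite_finite_induct) simp_all
  then show ?thesis by (simp add: mset_of_exponents_def)
qed

lemma size_mset_of_exponents: "size (mset_of_exponents m) = monom_degree m"
  unfolding mset_of_exponents_def monom_degree_def by simp

lemma mvpoly_eval_eq_sum:
  "mvpoly_eval v p = (\<Sum>m\<in>Poly_Mapping.keys p. Poly_Mapping.lookup p m * (\<Prod>i\<in>#mset_of_exponents m. v i))"
  by (simp add: mvpoly_eval_def prod_mset_of_exponents)

lemma prod_mvar: "(\<Prod>i\<in>#mset_of_exponents m. mvar i) = (Poly_Mapping.single m 1 :: 'k::comm_ring_1 mvpoly)"
proof -
  have pow: "mvar i ^ k = (Poly_Mapping.single (Poly_Mapping.single i k) 1 :: 'k mvpoly)" for i k
  proof (induction k)
    case (Suc k)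
    have "Poly_Mapping.single i (Suc k) = Poly_Mapping.single i 1 + Poly_Mapping.single i k"
      by (simp flip: single_add)
    with Suc show ?case by (simp add: mvar_def mult_single)
  qed simp
  have "(\<Prod>i\<in>A. Poly_Mapping.single (f i) 1) = (Poly_Mapping.single (\<Sum>i\<in>A. f i) 1 :: 'k mvpoly)" for A :: "nat set" and f
    by (induction A rule: infinite_finite_induct) (simp_all add: mult_single)
  then show ?thesis
    by (simp add: prod_mset_of_exponents pow sum_single_lookup)
qed

lemma mvpoly_eq_sum:
  "(\<Sum>m\<in>Poly_Mapping.keys p. Poly_Mapping.single 0 (Poly_Mapping.lookup p m) * (\<Prod>i\<in>#mset_of_exponents m. mvar i))
     = (p :: 'k::comm_ring_1 mvpoly)"
  using sum_single_lookup[of p] by (simp add: prod_mvar mult_single)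

section \<open>Forms vanishing on the variety\<close>

text \<open>
  For \<open>x \<noteq> 0\<close> fixed, evaluation at the moments for \<open>(\<xi>, \<xi> / x)\<close> gives, up to the factor \<open>x\<^sup>n\<close>,
  a polynomial in \<open>\<xi>\<close> whose \<open>w\<close>-th coefficient is the value of the part of weight \<open>w\<close> under
  \<open>M\<^sub>i \<mapsto> x + i\<close>.
\<close>

lemma homogeneous_in_ideal:
  fixes p :: "'k::field_char_0 mvpoly"
  assumes d: "6 \<le> d" and vars: "mvars p \<subseteq> {..d}" and hom: "homogeneous p"
    and zero: "\<And>\<xi> \<alpha>. mvpoly_eval (\<lambda>i. if i \<le> d then local_mixture_moment \<xi> \<alpha> i else 0) p = 0"
  shows "p \<in> moment_poly_ideal d"
proof -
  interpret quadric_sequence d "Poly_Mapping.single 0" "moment_poly_ideal d :: 'k mvpoly set" mvar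
    "\<lambda>x. mvpoly_eval (\<lambda>i. x + of_nat i)"
    using d by (rule quadric_sequence_mvar)
  obtain n where n: "\<And>m. m \<in> Poly_Mapping.keys p \<Longrightarrow> size (mset_of_exponents m) = n"
    using hom by (auto simp: homogeneous_def size_mset_of_exponents)
  have sub: "set_mset (mset_of_exponents m) \<subseteq> {..d}" if "m \<in> Poly_Mapping.keys p" for m
    using vars that by (auto simp: mvars_def set_mset_of_exponents)
  let ?wt = "\<lambda>m. sum_mset (mset_of_exponents m)"
  define W where "W = ?wt ` Poly_Mapping.keys p"
  define P where "P w = (\<Sum>m | m \<in> Poly_Mapping.keys p \<and> ?wt m = w.
    Poly_Mapping.single 0 (Poly_Mapping.lookup p m) * (\<Prod>i\<in>#mset_of_exponents m. mvar i))" for w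
  have p_eq: "p = (\<Sum>w\<in>W. P w)"
    unfolding P_def W_def by (subst sum.image_gen[symmetric]) (simp_all add: mvpoly_eq_sum)
  have P: "P w \<in> bihom d (Poly_Mapping.single 0) mvar n w" for w
    unfolding P_def by (intro bihom_sum bihom_term) (use n sub in auto)
  have ev_P: "mvpoly_eval (\<lambda>i. x + of_nat i) (P w)
      = (\<Sum>m | m \<in> Poly_Mapping.keys p \<and> ?wt m = w.
          Poly_Mapping.lookup p m * (\<Prod>i\<in>#mset_of_exponents m. x + of_nat i))" for x w
    unfolding P_def mvpoly_eval_sum by (rule sum.cong) (auto simp: mvpoly_eval_mult ev_monom sub)
  have "mvpoly_eval (\<lambda>i. x + of_nat i) (P w) = 0" if x: "x \<noteq> 0" for x w
  proof -
    define E where "E = (\<Sum>w\<in>W. monom (mvpoly_eval (\<lambda>i. x + of_nat i) (P w)) w)"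
    have "E = 0"
    proof (rule poly_eq_0_if_zero_off_0)
      fix \<xi> :: 'k assume \<xi>: "\<xi> \<noteq> 0"
      let ?v = "\<lambda>i. if i \<le> d then local_mixture_moment \<xi> (\<xi> / x) i else 0"
      have v: "?v i = \<xi> ^ i * ((x + of_nat i) / x)" if "i \<le> d" for i
        using x that by (cases i) (simp_all add: local_mixture_moment_def field_simps)
      have prod_v: "(\<Prod>i\<in>#M. ?v i) = \<xi> ^ sum_mset M * (\<Prod>i\<in>#M. x + of_nat i) / x ^ size M"
        if "set_mset M \<subseteq> {..d}" for M
        using that
      proof (induction M)
        case (add i M)
        then have "i \<le> d" by simp
        from v[OF this] add show ?case by (simp add: power_add)
      qed simp
      have "poly E \<xi> = (\<Sum>w\<in>W. \<Sum>m | m \<in> Poly_Mapping.keys p \<and> ?wt m = w.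
          \<xi> ^ ?wt m * (Poly_Mapping.lookup p m * (\<Prod>i\<in>#mset_of_exponents m. x + of_nat i)))"
        unfolding E_def poly_sum ev_P
        by (intro sum.cong) (auto simp: poly_monom sum_distrib_left mult_ac intro!: sum.cong)
      also have "\<dots> = (\<Sum>m\<in>Poly_Mapping.keys p.
          \<xi> ^ ?wt m * (Poly_Mapping.lookup p m * (\<Prod>i\<in>#mset_of_exponents m. x + of_nat i)))"
        unfolding W_def by (subst sum.image_gen[symmetric]) simp_all
      also have "\<dots> = (\<Sum>m\<in>Poly_Mapping.keys p.
          x ^ n * (Poly_Mapping.lookup p m * (\<Prod>i\<in>#mset_of_exponents m. ?v i)))"
      proof (rule sum.cong)
        fix m assume m: "m \<in> Poly_Mapping.keys p"
        show "\<xi> ^ ?wt m * (Poly_Mapping.lookup p m * (\<Prod>i\<in>#mset_of_exponents m. x + of_nat i))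
          = x ^ n * (Poly_Mapping.lookup p m * (\<Prod>i\<in>#mset_of_exponents m. ?v i))"
          unfolding prod_v[OF sub[OF m]] n[OF m] using x by (simp add: field_simps)
      qed simp
      also have "\<dots> = x ^ n * mvpoly_eval ?v p"
        by (simp only: mvpoly_eval_eq_sum sum_distrib_left)
      finally show "poly E \<xi> = 0" by (simp only: zero mult_zero_right)
    qed
    have "finite W" by (simp add: W_def)
    then have "coeff E w = (if w \<in> W then mvpoly_eval (\<lambda>i. x + of_nat i) (P w) else 0)"
      unfolding E_def coeff_sum by (simp add: sum.delta when_def)
    moreover have "P w = 0" if "w \<notin> W"
    proof -
      have "{m. m \<in> Poly_Mapping.keys p \<and> ?wt m = w} = {}" using that by (auto simp: W_def)
      then show ?thesis unfolding P_def by (simp only: sum.empty)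
    qed
    ultimately show ?thesis using \<open>E = 0\<close> ev_0 by (cases "w \<in> W") auto
  qed
  then have "mvpoly_eval (\<lambda>i. x + of_nat i) (P w) = 0" for x w
    using ev_eq_0[OF P[of w]] by blast
  then have "P w \<in> moment_poly_ideal d" for w
    by (rule bihom_kernel_subset[OF quadric_sequence_axioms P])
  then have "(\<Sum>w\<in>A. P w) \<in> moment_poly_ideal d" for A
    by (induction A rule: infinite_finite_induct) (simp_all add: J_0 J_add)
  then show ?thesis using p_eq by metis
qed

section \<open>The quadrics vanish on the variety\<close>

lemma mvpoly_keys_diff:
  "Poly_Mapping.keys (p - q :: 'k::field mvpoly) \<subseteq> Poly_Mapping.keys p \<union> Poly_Mapping.keys q"
  by (auto simp: in_keys_iff lookup_minus)

lemma homogeneous_moment_poly: "homogeneous (moment_poly i j :: 'k::field mvpoly)"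
proof -
  define T where "T n a b = (of_nat n * mvar a * mvar b :: 'k mvpoly)" for n a b
  have T: "monom_degree m = 2" if "m \<in> Poly_Mapping.keys (T n a b)" for m n a b
  proof -
    have "T n a b = Poly_Mapping.single (Poly_Mapping.single a 1 + Poly_Mapping.single b 1) (of_nat n)"
      by (simp add: T_def mvar_def mult_single flip: single_of_nat)
    then have m: "m = Poly_Mapping.single a 1 + Poly_Mapping.single b 1"
      using that by (auto split: if_splits)
    have "monom_degree m = (\<Sum>i\<in>{a, b}. Poly_Mapping.lookup m i)"
      unfolding monom_degree_def
      by (intro sum.mono_neutral_left) (auto simp: m in_keys_iff lookup_add lookup_single when_def split: if_splits)
    also have "\<dots> = 2" by (cases "a = b") (simp_all add: m lookup_add lookup_single)
    finally show ?thesis .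
  qed
  let ?A = "T (j - i + 3) i j" and ?B = "T (2 * (j - i + 2)) (i - 1) (j + 1)"
    and ?C = "T (j - i + 1) (i - 2) (j + 2)"
  have eq: "moment_poly i j = ?A - ?B + ?C"
    unfolding moment_poly_def T_def of_nat_mult of_nat_numeral ..
  have "Poly_Mapping.keys (moment_poly i j :: 'k mvpoly)
      \<subseteq> Poly_Mapping.keys ?A \<union> Poly_Mapping.keys ?B \<union> Poly_Mapping.keys ?C"
    unfolding eq using Poly_Mapping.keys_add[of "?A - ?B" ?C] mvpoly_keys_diff[of ?A ?B] by blast
  then show ?thesis
    unfolding homogeneous_def using T by blast
qed

lemma local_mixture_moment_Suc:
  "local_mixture_moment \<xi> \<alpha> (Suc k) = \<xi> ^ k * (\<xi> + of_nat (Suc k) * \<alpha>)"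
  by (simp add: local_mixture_moment_def algebra_simps)

lemma moment_poly_local_mixture_moment:
  assumes "2 \<le> i" "i \<le> j"
  shows "mvpoly_eval (local_mixture_moment \<xi> \<alpha>) (moment_poly i j) = 0"
proof -
  obtain a where a: "i = Suc (Suc a)" using that[of "i - 2"] assms(1) by simp
  obtain D where D: "j = Suc (Suc (a + D))" using that[of "j - i"] assms(2) a by simp
  have 0: "local_mixture_moment \<xi> \<alpha> 0 = 1" by (simp add: local_mixture_moment_def)
  show ?thesis
    unfolding mvpoly_eval_moment_poly
    by (cases a) (simp_all add: a D 0 local_mixture_moment_Suc power_add algebra_simps)
qed

lemma moment_poly_vanishes:
  assumes "2 \<le> i" "i \<le> j" "j \<le> d - 2"
  shows "vanishes_at (moment_poly i j) (proj_point d (local_mixture_moment \<xi> \<alpha>))"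
  unfolding vanishes_at_def
proof
  fix v assume "v \<in> proj_point d (local_mixture_moment \<xi> \<alpha>)"
  then obtain c where v: "v = (\<lambda>i. c * (if i \<le> d then local_mixture_moment \<xi> \<alpha> i else 0))"
    by (auto simp: proj_point_def proj_rel_def)
  have "i \<le> d" "j \<le> d" "i - 1 \<le> d" "j + 1 \<le> d" "i - 2 \<le> d" "j + 2 \<le> d"
    using assms by linarith+
  then have le: "(i \<le> d) = True" "(j \<le> d) = True" "(i - 1 \<le> d) = True" "(j + 1 \<le> d) = True"
    "(i - 2 \<le> d) = True" "(j + 2 \<le> d) = True" by simp_all
  have "mvpoly_eval v (moment_poly i j) = c * c * mvpoly_eval (local_mixture_moment \<xi> \<alpha>) (moment_poly i j)"
    unfolding mvpoly_eval_moment_poly v le if_True by (simp only: right_diff_distrib distrib_left mult_ac)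
  then show "mvpoly_eval v (moment_poly i j) = 0"
    using assms by (simp add: moment_poly_local_mixture_moment)
qed

theorem theorem3p1:
  fixes d :: nat
  assumes "d \<ge> 6"
  shows "(moment_poly_ideal d :: 'k::{alg_closed_field, field_char_0} mvpoly set)
           = vanishing_ideal d (moment_variety d)"
proof -
  interpret R: cring "mvpoly_ring d :: 'k mvpoly ring" by (rule cring_mvpoly_ring)
  let ?A = "{proj_point d (local_mixture_moment \<xi> \<alpha>) | \<xi> \<alpha>. True} :: (nat \<Rightarrow> 'k) set set"
  let ?G = "{moment_poly i j | i j. 2 \<le> i \<and> i \<le> j \<and> j \<le> d - 2} :: 'k mvpoly set"
  let ?V = "{p \<in> carrier (mvpoly_ring d). homogeneous p \<and> (\<forall>P\<in>moment_variety d. vanishes_at p P)} :: 'k mvpoly set"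
  have "?G \<subseteq> ?V"
  proof
    fix p assume "p \<in> ?G"
    then obtain i j where ij: "2 \<le> i" "i \<le> j" "j \<le> d - 2" and p: "p = moment_poly i j" by blast
    have carrier: "p \<in> carrier (mvpoly_ring d)" and hom: "homogeneous p"
      unfolding p using moment_poly_in_carrier[OF ij] homogeneous_moment_poly by blast+
    have "moment_variety d \<subseteq> {P \<in> proj_space d. \<forall>q\<in>{p}. vanishes_at q P}"
      unfolding moment_variety_def zariski_closure_def
    proof (rule hull_minimal)
      show "?A \<subseteq> {P \<in> proj_space d. \<forall>q\<in>{p}. vanishes_at q P}"
        by (auto simp: p proj_point_moment_in_proj_space moment_poly_vanishes[OF ij])
      show "zariski_closed d {P \<in> proj_space d. \<forall>q\<in>{p}. vanishes_at q P}"
        unfolding zariski_closed_def by (rule exI[of _ "{p}"]) (use carrier hom in simp)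
    qed
    then show "p \<in> ?V" using carrier hom by blast
  qed
  then have "moment_poly_ideal d \<subseteq> vanishing_ideal d (moment_variety d :: (nat \<Rightarrow> 'k) set set)"
    unfolding moment_poly_ideal_def vanishing_ideal_def
    by (intro R.subset_Idl_subset) auto
  moreover have "?V \<subseteq> moment_poly_ideal d"
  proof
    fix p assume p: "p \<in> ?V"
    have "mvpoly_eval (\<lambda>i. if i \<le> d then local_mixture_moment \<xi> \<alpha> i else 0) p = 0" for \<xi> \<alpha>
    proof -
      let ?v = "\<lambda>i. if i \<le> d then local_mixture_moment \<xi> \<alpha> i else 0"
      have "?A \<subseteq> moment_variety d"
        unfolding moment_variety_def zariski_closure_def by (rule hull_subset)
      then have "vanishes_at p (proj_point d (local_mixture_moment \<xi> \<alpha>))" using p by blast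
      moreover have "?v \<in> homog_coords d"
        by (auto simp: homog_coords_def local_mixture_moment_def intro!: exI[of _ 0])
      then have "?v \<in> proj_point d (local_mixture_moment \<xi> \<alpha>)"
        by (auto simp: proj_point_def proj_rel_def intro!: exI[of _ 1])
      ultimately show ?thesis unfolding vanishes_at_def by blast
    qed
    then show "p \<in> moment_poly_ideal d"
      using p assms by (intro homogeneous_in_ideal) auto
  qed
  then have "vanishing_ideal d (moment_variety d) \<subseteq> (moment_poly_ideal d :: 'k mvpoly set)"
    unfolding vanishing_ideal_def by (rule R.genideal_minimal[OF ideal_moment_poly_ideal])
  ultimately show ?thesis by (rule subset_antisym)
qed

end
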